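(* Let $K$ be a field, $n\ge1$, and $R=R(K[X_1,\ldots,X_n])$. Then the Krull dimension of $R$ is $\dim R=n$.
   Context: For an integral domain $T$, the reciprocal complement $R(T)$ is the subring of the fraction field of $T$ generated by all $1/f$ with $f\in T\setminus\{0\}$. Here $K[X_1,\ldots,X_n]$ is the polynomial ring in $n$ variables over $K$. *)

theory Defs
  imports
    "HOL-Library.Poly_Mapping"
    "HOL-Library.Extended_Nat"
    "HOL-Library.Numeral_Type"
    "HOL-Computational_Algebra.Fraction_Field"
    "HOL-Algebra.Ideal"
    "HOL-Algebra.Generated_Rings"
    "HOL-Algebra.Algebraic_Closure_Type"
begin

text \<open>
  The polynomial ring over \<open>'k\<close> in variables indexed by \<open>'v\<close>: a monomial is a finitely supported
  exponent vector \<open>'v \<Rightarrow>\<^sub>0 nat\<close>, and multiplication of \<open>\<Rightarrow>\<^sub>0\<close> is convolution. The library makes this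
  type an integral domain when \<open>'k\<close> is one and \<open>'v\<close> is linearly ordered; the order plays no other
  role. With \<open>'v\<close> finite this is the polynomial ring in \<open>CARD('v)\<close> variables.
\<close>

type_synonym ('k, 'v) mpolys = "('v \<Rightarrow>\<^sub>0 nat) \<Rightarrow>\<^sub>0 'k"

text \<open>
  The set \<open>generate_ring F H\<close> is the smallest subring (with \<open>1\<close>) of \<open>F\<close> containing \<open>H\<close>;
  \<open>Fract 1 f\<close> is the fraction \<open>1 / f\<close>.
\<close>

definition reciprocal_complement :: "'a::idom itself \<Rightarrow> 'a fract ring" where
  "reciprocal_complement _ =
     (ring_of_type_algebra :: 'a fract ring)
       \<lparr>carrier := generate_ring (ring_of_type_algebra :: 'a fract ring)
                      {Fraction_Field.Fract 1 f | f. f \<noteq> 0}\<rparr>"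

text \<open>
  The supremum of the lengths \<open>k\<close> of strict chains \<open>P 0 \<subset> P 1 \<subset> \<dots> \<subset> P k\<close> of prime ideals. The
  zero ring, which has no prime ideals, gets the value \<open>0\<close>.
\<close>

definition krull_dim :: "('a, 'b) ring_scheme \<Rightarrow> enat" where
  "krull_dim R =
     Sup {enat k | k. \<exists>P :: nat \<Rightarrow> 'a set.
            (\<forall>i\<le>k. primeideal (P i) R) \<and> (\<forall>i<k. P i \<subset> P (Suc i))}"

end

theory Submission
  imports Defs
begin

text \<open>
  Write \<open>R\<close> for the reciprocal complement of \<open>K[X\<^sub>1, \<dots>, X\<^sub>n]\<close>. It contains \<open>K\<close>, because every
  nonzero constant is the reciprocal of a constant.

  Lower bound. Let \<open>d\<close> be a degree on polynomials with values in an ordered monoid, additive on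
  products, bounded by the maximum on sums, and nonnegative. It extends to a valuation on the fraction
  field, and since \<open>d 1 \<le> d f\<close> every generator \<open>1 / f\<close> of \<open>R\<close> is an integer of that valuation.
  Hence the fractions \<open>a / b \<in> R\<close> with \<open>d a < d b\<close> form a prime ideal of \<open>R\<close>
  (\<open>degree_map.primeideal_neg\<close>). Such degrees come from the lexicographic order on monomials: take the
  exponent vector of the leading monomial and forget all but the \<open>j\<close> most significant variables.
  For \<open>j = 0\<close> this degree vanishes and the prime is the zero ideal. Passing from \<open>j\<close> to \<open>j + 1\<close>
  enlarges the prime, and strictly so, because the reciprocal of the newly counted variable enters.
  This gives \<open>n + 1\<close> primes (\<open>prime_chain_exists\<close>).

  Upper bound. Let \<open>P\<^sub>0 \<subset> \<dots> \<subset> P\<^sub>k\<close> be primes of \<open>R\<close> and choose \<open>x\<^sub>i \<in> P\<^sub>i - P\<^bsub>i-1\<^esub>\<close>. The \<open>x\<^sub>i\<close> are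
  algebraically independent over \<open>K\<close> (\<open>prime_chain_independent\<close>): in a relation lying in \<open>P\<^sub>0\<close>,
  divide by the smallest power of \<open>x\<^sub>1\<close> that occurs, which is allowed since \<open>x\<^sub>1 \<notin> P\<^sub>0\<close>; modulo \<open>P\<^sub>1\<close>
  the terms that still contain \<open>x\<^sub>1\<close> vanish and a relation among \<open>x\<^sub>2, \<dots>, x\<^sub>k\<close> remains.
  But more than \<open>n\<close> rational functions in \<open>n\<close> variables are dependent by counting
  (\<open>monomials_dependent\<close>): the \<open>(N + 1)\<^sup>k\<close> monomials in the \<open>x\<^sub>i\<close> with exponents at most \<open>N\<close> have a
  common denominator that moves them into a space of polynomials of dimension \<open>O(N\<^sup>n)\<close>.
\<close>

section \<open>The reciprocal complement as a subring of the fraction field\<close>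

abbreviation reciprocal_ring :: "'a::idom itself \<Rightarrow> 'a fract set" where
  "reciprocal_ring T \<equiv> carrier (reciprocal_complement T)"

lemma type_algebra_simps:
  "carrier (ring_of_type_algebra :: 'a::ring_1 ring) = UNIV"
  "x \<oplus>\<^bsub>(ring_of_type_algebra :: 'a ring)\<^esub> y = x + y"
  "x \<otimes>\<^bsub>(ring_of_type_algebra :: 'a ring)\<^esub> y = x * y"
  "\<zero>\<^bsub>(ring_of_type_algebra :: 'a ring)\<^esub> = 0"
  "\<one>\<^bsub>(ring_of_type_algebra :: 'a ring)\<^esub> = 1"
  by (simp_all add: ring_of_type_algebra_def)

lemma type_algebra_a_inv: "\<ominus>\<^bsub>(ring_of_type_algebra :: 'a::comm_ring_1 ring)\<^esub> x = - x"
proof -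
  interpret ring "ring_of_type_algebra :: 'a ring" by (rule ring_from_type_algebra)
  have "\<ominus>\<^bsub>(ring_of_type_algebra :: 'a ring)\<^esub> (- (- x)) = - x"
    by (rule minus_equality) (simp_all add: type_algebra_simps)
  then show ?thesis by simp
qed

lemma reciprocal_complement_simps:
  fixes x y :: "'a::idom fract"
  shows "x \<oplus>\<^bsub>reciprocal_complement TYPE('a)\<^esub> y = x + y"
  "x \<otimes>\<^bsub>reciprocal_complement TYPE('a)\<^esub> y = x * y"
  "\<zero>\<^bsub>reciprocal_complement TYPE('a)\<^esub> = 0"
  "\<one>\<^bsub>reciprocal_complement TYPE('a)\<^esub> = 1"
  by (simp_all add: reciprocal_complement_def ring_of_type_algebra_def)

lemma reciprocal_ring_eq:
  "reciprocal_ring TYPE('a::idom) =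
     generate_ring (ring_of_type_algebra :: 'a fract ring) {Fraction_Field.Fract 1 f | f. f \<noteq> 0}"
  by (simp add: reciprocal_complement_def)

lemma cring_reciprocal_complement: "cring (reciprocal_complement TYPE('a::idom))"
proof -
  interpret F: cring "ring_of_type_algebra :: 'a fract ring" by (rule cring_from_type_algebra)
  show ?thesis
    unfolding reciprocal_complement_def
    by (intro F.subcring_iff[THEN iffD1] F.subcringI' F.generate_ring_is_subring F.generate_ring_incl)
       (simp_all add: type_algebra_simps)
qed

lemma reciprocal_ring_closed:
  shows reciprocal_ring_one: "1 \<in> reciprocal_ring TYPE('a::idom)"
    and reciprocal_ring_zero: "0 \<in> reciprocal_ring TYPE('a)"
    and reciprocal_ring_add:
      "\<And>x y. x \<in> reciprocal_ring TYPE('a) \<Longrightarrow> y \<in> reciprocal_ring TYPE('a) \<Longrightarrow> x + y \<in> reciprocal_ring TYPE('a)"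
    and reciprocal_ring_mult:
      "\<And>x y. x \<in> reciprocal_ring TYPE('a) \<Longrightarrow> y \<in> reciprocal_ring TYPE('a) \<Longrightarrow> x * y \<in> reciprocal_ring TYPE('a)"
proof -
  interpret cring "reciprocal_complement TYPE('a)" by (rule cring_reciprocal_complement)
  show "1 \<in> reciprocal_ring TYPE('a)" "0 \<in> reciprocal_ring TYPE('a)"
    using one_closed zero_closed by (simp_all add: reciprocal_complement_simps)
  show "\<And>x y. x \<in> reciprocal_ring TYPE('a) \<Longrightarrow> y \<in> reciprocal_ring TYPE('a) \<Longrightarrow> x + y \<in> reciprocal_ring TYPE('a)"
    using add.m_closed by (simp add: reciprocal_complement_simps)
  show "\<And>x y. x \<in> reciprocal_ring TYPE('a) \<Longrightarrow> y \<in> reciprocal_ring TYPE('a) \<Longrightarrow> x * y \<in> reciprocal_ring TYPE('a)"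
    using m_closed by (simp add: reciprocal_complement_simps)
qed

lemma reciprocal_ring_uminus:
  "x \<in> reciprocal_ring TYPE('a::idom) \<Longrightarrow> - x \<in> reciprocal_ring TYPE('a)"
  using generate_ring.a_inv[of x "ring_of_type_algebra :: 'a fract ring"]
  by (simp add: reciprocal_ring_eq type_algebra_a_inv)

lemma reciprocal_ring_inverse:
  "f \<noteq> 0 \<Longrightarrow> Fraction_Field.Fract 1 f \<in> reciprocal_ring TYPE('a::idom)"
  by (auto simp: reciprocal_ring_eq intro: generate_ring.incl)

text \<open>
  This lemma and its converse replace the record operations of \<open>reciprocal_complement\<close> by the
  arithmetic of the type of fractions, in which all later arguments take place.
\<close>

lemma primeideal_reciprocal_complementI:
  assumes "P \<subseteq> reciprocal_ring TYPE('a::idom)" "0 \<in> P" "1 \<notin> P"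
    and "\<And>x y. x \<in> P \<Longrightarrow> y \<in> P \<Longrightarrow> x + y \<in> P"
    and "\<And>r x. r \<in> reciprocal_ring TYPE('a) \<Longrightarrow> x \<in> P \<Longrightarrow> r * x \<in> P"
    and "\<And>x y. x \<in> reciprocal_ring TYPE('a) \<Longrightarrow> y \<in> reciprocal_ring TYPE('a) \<Longrightarrow> x * y \<in> P
           \<Longrightarrow> x \<in> P \<or> y \<in> P"
  shows "primeideal P (reciprocal_complement TYPE('a))"
proof -
  interpret R: cring "reciprocal_complement TYPE('a)" by (rule cring_reciprocal_complement)
  have a_inv: "\<ominus>\<^bsub>reciprocal_complement TYPE('a)\<^esub> x = - x" if "x \<in> reciprocal_ring TYPE('a)" for x
    using that by (intro R.minus_equality) (simp_all add: reciprocal_complement_simps reciprocal_ring_uminus)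
  have "- x \<in> P" if "x \<in> P" for x
    using assms(5)[OF reciprocal_ring_uminus[OF reciprocal_ring_one] that] by simp
  then have "subgroup P (add_monoid (reciprocal_complement TYPE('a)))"
    using assms(1-4) a_inv
    by (intro R.add.subgroupI) (auto simp: reciprocal_complement_simps subset_iff)
  then have "additive_subgroup P (reciprocal_complement TYPE('a))"
    by (rule additive_subgroupI)
  moreover have "reciprocal_ring TYPE('a) \<noteq> P"
    using assms(3) reciprocal_ring_one by blast
  moreover have right_closed: "x * r \<in> P" if "x \<in> P" "r \<in> reciprocal_ring TYPE('a)" for r x
    using assms(5)[OF that(2,1)] by (simp add: mult.commute)
  ultimately show ?thesis
    using assms(5,6) right_closed
    by (intro primeidealI2 R.is_cring) (simp_all add: reciprocal_complement_simps)
qed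

lemma primeideal_reciprocal_complementD:
  assumes "primeideal P (reciprocal_complement TYPE('a::idom))"
  shows "P \<subseteq> reciprocal_ring TYPE('a)" "0 \<in> P" "1 \<notin> P"
    and "\<And>x y. x \<in> P \<Longrightarrow> y \<in> P \<Longrightarrow> x + y \<in> P"
    and "\<And>r x. r \<in> reciprocal_ring TYPE('a) \<Longrightarrow> x \<in> P \<Longrightarrow> r * x \<in> P"
    and "\<And>x y. x \<in> reciprocal_ring TYPE('a) \<Longrightarrow> y \<in> reciprocal_ring TYPE('a) \<Longrightarrow> x * y \<in> P
           \<Longrightarrow> x \<in> P \<or> y \<in> P"
proof -
  interpret primeideal P "reciprocal_complement TYPE('a)" by (rule assms)
  show "P \<subseteq> reciprocal_ring TYPE('a)" by (rule a_subset)
  show "0 \<in> P" using additive_subgroup.zero_closed[OF is_additive_subgroup] by (simp add: reciprocal_complement_simps)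
  show "1 \<notin> P" using I_notcarr one_imp_carrier by (auto simp: reciprocal_complement_simps)
  show "\<And>x y. x \<in> P \<Longrightarrow> y \<in> P \<Longrightarrow> x + y \<in> P"
    using additive_subgroup.a_closed[OF is_additive_subgroup] by (simp add: reciprocal_complement_simps)
  show "\<And>r x. r \<in> reciprocal_ring TYPE('a) \<Longrightarrow> x \<in> P \<Longrightarrow> r * x \<in> P"
    using I_l_closed by (simp add: reciprocal_complement_simps)
  show "\<And>x y. x \<in> reciprocal_ring TYPE('a) \<Longrightarrow> y \<in> reciprocal_ring TYPE('a) \<Longrightarrow> x * y \<in> P
           \<Longrightarrow> x \<in> P \<or> y \<in> P"
    using I_prime by (simp add: reciprocal_complement_simps)
qed

section \<open>Prime ideals from degrees\<close>

text \<open>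
  A degree with values in an ordered cancellative monoid: \<open>d a - d b\<close>, in the group of differences,
  is the negative of a valuation of \<open>a / b\<close>. Comparing \<open>d a\<close> with \<open>d b\<close> avoids that group and also
  covers degrees that are vectors of natural numbers. The value at \<open>0\<close> is left open.
\<close>

locale degree_map =
  fixes d :: "'a::idom \<Rightarrow> 'g::{linordered_cancel_ab_semigroup_add, ordered_comm_monoid_add}"
  assumes mult: "f \<noteq> 0 \<Longrightarrow> g \<noteq> 0 \<Longrightarrow> d (f * g) = d f + d g"
    and add: "f \<noteq> 0 \<Longrightarrow> g \<noteq> 0 \<Longrightarrow> f + g \<noteq> 0 \<Longrightarrow> d (f + g) \<le> max (d f) (d g)"
    and nonneg: "f \<noteq> 0 \<Longrightarrow> 0 \<le> d f"
begin

text \<open>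
  The valuation ring of the degree, the fractions of degree at most \<open>0\<close>; its maximal ideal is the
  set \<open>neg\<close> below.
\<close>

definition nonpos :: "'a fract set" where
  "nonpos = {Fraction_Field.Fract a b | a b. b \<noteq> 0 \<and> (a = 0 \<or> d a \<le> d b)}"

definition neg :: "'a fract set" where
  "neg = {Fraction_Field.Fract a b | a b. b \<noteq> 0 \<and> (a = 0 \<or> d a < d b)}"

lemma degree_one: "d 1 = 0"
  by (rule add_left_imp_eq[of "d 1"]) (use mult[of 1 1] in simp)

lemma degree_uminus: "f \<noteq> 0 \<Longrightarrow> d (- f) = d f"
proof -
  assume f: "f \<noteq> 0"
  have "d (- 1) + d (- 1) = 0" using mult[of "-1" "-1"] degree_one by simp
  then have "d (- 1) = 0" using nonneg[of "-1"] by (simp add: add_nonneg_eq_0_iff)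
  then show ?thesis using mult[of "-1" f] f by simp
qed

text \<open>
  Membership does not depend on the representative: \<open>a / b = a' / b'\<close> means \<open>a b' = a' b\<close>, so
  \<open>d a + d b' = d a' + d b\<close>, and the monoid is cancellative.
\<close>

lemma
  assumes "b \<noteq> 0"
  shows Fract_in_nonpos_iff: "Fraction_Field.Fract a b \<in> nonpos \<longleftrightarrow> a = 0 \<or> d a \<le> d b"
    and Fract_in_neg_iff: "Fraction_Field.Fract a b \<in> neg \<longleftrightarrow> a = 0 \<or> d a < d b"
proof -
  have cross: "d a + d b' = d a' + d b"
    if "Fraction_Field.Fract a b = Fraction_Field.Fract a' b'" "b' \<noteq> 0" "a \<noteq> 0" "a' \<noteq> 0" for a' b'
    using that assms mult[of a b'] mult[of a' b] by (simp add: eq_fract)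
  have zero: "a = 0 \<longleftrightarrow> a' = 0" if "Fraction_Field.Fract a b = Fraction_Field.Fract a' b'" "b' \<noteq> 0" for a' b'
    using that assms by (auto simp: eq_fract)
  show "Fraction_Field.Fract a b \<in> nonpos \<longleftrightarrow> a = 0 \<or> d a \<le> d b"
  proof
    assume "Fraction_Field.Fract a b \<in> nonpos"
    then obtain a' b' where *: "Fraction_Field.Fract a b = Fraction_Field.Fract a' b'" "b' \<noteq> 0" "a' = 0 \<or> d a' \<le> d b'"
      by (auto simp: nonpos_def)
    show "a = 0 \<or> d a \<le> d b"
    proof (cases "a = 0")
      case False
      with * zero have "d a' \<le> d b'" and e: "d a + d b' = d a' + d b" using cross by blast+
      from \<open>d a' \<le> d b'\<close> have "d a + d b' \<le> d b + d b'"
        unfolding e add.commute[of "d b" "d b'"] by (rule add_right_mono)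
      then show ?thesis by simp
    qed simp
  qed (use assms in \<open>auto simp: nonpos_def\<close>)
  show "Fraction_Field.Fract a b \<in> neg \<longleftrightarrow> a = 0 \<or> d a < d b"
  proof
    assume "Fraction_Field.Fract a b \<in> neg"
    then obtain a' b' where *: "Fraction_Field.Fract a b = Fraction_Field.Fract a' b'" "b' \<noteq> 0" "a' = 0 \<or> d a' < d b'"
      by (auto simp: neg_def)
    show "a = 0 \<or> d a < d b"
    proof (cases "a = 0")
      case False
      with * zero have "d a' < d b'" and e: "d a + d b' = d a' + d b" using cross by blast+
      from \<open>d a' < d b'\<close> have "d a + d b' < d b + d b'"
        unfolding e add.commute[of "d b" "d b'"] by (rule add_strict_right_mono)
      then show ?thesis by simp
    qed simp
  qed (use assms in \<open>auto simp: neg_def\<close>)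
qed

lemma nonpos_mult: "x \<in> nonpos \<Longrightarrow> y \<in> nonpos \<Longrightarrow> x * y \<in> nonpos"
proof -
  assume "x \<in> nonpos" "y \<in> nonpos"
  then obtain a b a' b' where *: "x = Fraction_Field.Fract a b" "b \<noteq> 0" "a = 0 \<or> d a \<le> d b"
    "y = Fraction_Field.Fract a' b'" "b' \<noteq> 0" "a' = 0 \<or> d a' \<le> d b'"
    by (auto simp: nonpos_def)
  then show ?thesis by (cases "a = 0 \<or> a' = 0") (auto simp: Fract_in_nonpos_iff mult add_mono)
qed

lemma neg_add: 
  assumes "x \<in> neg" "y \<in> neg" shows "x + y \<in> neg"
proof -
  obtain a b a' b' where *: "x = Fraction_Field.Fract a b" "b \<noteq> 0" "a = 0 \<or> d a < d b"
    "y = Fraction_Field.Fract a' b'" "b' \<noteq> 0" "a' = 0 \<or> d a' < d b'"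
    using assms by (auto simp: neg_def)
  have 1: "d (a * b') < d (b * b')" if "a \<noteq> 0"
    using that * by (simp add: mult add_strict_right_mono)
  have 2: "d (a' * b) < d (b * b')" if "a' \<noteq> 0"
    using that * add_strict_right_mono[of "d a'" "d b'" "d b"] by (simp add: mult add.commute)
  have "a * b' + a' * b = 0 \<or> d (a * b' + a' * b) < d (b * b')"
  proof (cases "a = 0 \<or> a' = 0 \<or> a * b' + a' * b = 0")
    case False
    then have "d (a * b' + a' * b) \<le> max (d (a * b')) (d (a' * b))" using * by (intro add) auto
    with False 1 2 show ?thesis by (auto simp: max_def split: if_splits)
  qed (use 1 2 in \<open>cases "a = 0"; cases "a' = 0"; simp\<close>)
  then show ?thesis using * by (simp add: Fract_in_neg_iff)
qed

lemma nonpos_add: 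
  assumes "x \<in> nonpos" "y \<in> nonpos" shows "x + y \<in> nonpos"
proof -
  obtain a b a' b' where *: "x = Fraction_Field.Fract a b" "b \<noteq> 0" "a = 0 \<or> d a \<le> d b"
    "y = Fraction_Field.Fract a' b'" "b' \<noteq> 0" "a' = 0 \<or> d a' \<le> d b'"
    using assms by (auto simp: nonpos_def)
  have 1: "d (a * b') \<le> d (b * b')" if "a \<noteq> 0"
    using that * by (simp add: mult add_right_mono)
  have 2: "d (a' * b) \<le> d (b * b')" if "a' \<noteq> 0"
    using that * add_right_mono[of "d a'" "d b'" "d b"] by (simp add: mult add.commute)
  have "a * b' + a' * b = 0 \<or> d (a * b' + a' * b) \<le> d (b * b')"
  proof (cases "a = 0 \<or> a' = 0 \<or> a * b' + a' * b = 0")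
    case False
    then have "d (a * b' + a' * b) \<le> max (d (a * b')) (d (a' * b))" using * by (intro add) auto
    with False 1 2 show ?thesis by (auto simp: max_def split: if_splits)
  qed (use 1 2 in \<open>cases "a = 0"; cases "a' = 0"; simp\<close>)
  then show ?thesis using * by (simp add: Fract_in_nonpos_iff)
qed

text \<open>
  This is where \<open>nonneg\<close> matters: it puts every generator \<open>1 / f\<close> into the valuation ring.
\<close>

lemma reciprocal_ring_nonpos: "reciprocal_ring TYPE('a) \<subseteq> nonpos"
proof
  fix x :: "'a fract"
  assume "x \<in> reciprocal_ring TYPE('a)"
  then show "x \<in> nonpos"
    unfolding reciprocal_ring_eq
  proof induction
    case one
    show ?case by (auto simp: type_algebra_simps One_fract_def Fract_in_nonpos_iff)
  next
    case (incl h)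
    then show ?case by (auto simp: Fract_in_nonpos_iff degree_one nonneg)
  next
    case (a_inv h)
    then obtain a b where "h = Fraction_Field.Fract a b" "b \<noteq> 0" "a = 0 \<or> d a \<le> d b"
      by (auto simp: nonpos_def)
    then show ?case
      by (cases "a = 0") (auto simp: type_algebra_a_inv Fract_in_nonpos_iff degree_uminus)
  qed (simp_all add: type_algebra_simps nonpos_add nonpos_mult)
qed

lemma neg_mult: 
  assumes "x \<in> nonpos" "y \<in> neg" shows "x * y \<in> neg"
proof -
  obtain a b a' b' where *: "x = Fraction_Field.Fract a b" "b \<noteq> 0" "a = 0 \<or> d a \<le> d b"
    "y = Fraction_Field.Fract a' b'" "b' \<noteq> 0" "a' = 0 \<or> d a' < d b'"
    using assms by (auto simp: neg_def nonpos_def)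
  then show ?thesis by (cases "a = 0 \<or> a' = 0") (auto simp: Fract_in_neg_iff mult add_le_less_mono)
qed

lemma neg_prime: 
  assumes "x \<in> nonpos" "y \<in> nonpos" "x * y \<in> neg" shows "x \<in> neg \<or> y \<in> neg"
proof -
  obtain a b a' b' where *: "x = Fraction_Field.Fract a b" "b \<noteq> 0" "a = 0 \<or> d a \<le> d b"
    "y = Fraction_Field.Fract a' b'" "b' \<noteq> 0" "a' = 0 \<or> d a' \<le> d b'"
    using assms by (auto simp: nonpos_def)
  with assms(3) show ?thesis
    by (cases "a = 0 \<or> a' = 0") (auto simp: Fract_in_neg_iff mult order.order_iff_strict)
qed

text \<open>
  The prime is the contraction of the maximal ideal of the valuation ring \<open>nonpos\<close> (the center
  of the valuation).
\<close>

lemma primeideal_neg: "primeideal (neg \<inter> reciprocal_ring TYPE('a)) (reciprocal_complement TYPE('a))"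
proof (rule primeideal_reciprocal_complementI)
  show "1 \<notin> neg \<inter> reciprocal_ring TYPE('a)" by (simp add: One_fract_def Fract_in_neg_iff)
  show "0 \<in> neg \<inter> reciprocal_ring TYPE('a)"
    using reciprocal_ring_zero by (simp add: Zero_fract_def Fract_in_neg_iff)
next
  fix x y assume "x \<in> neg \<inter> reciprocal_ring TYPE('a)" "y \<in> neg \<inter> reciprocal_ring TYPE('a)"
  then show "x + y \<in> neg \<inter> reciprocal_ring TYPE('a)" by (simp add: reciprocal_ring_add neg_add)
next
  fix r x assume "r \<in> reciprocal_ring TYPE('a)" "x \<in> neg \<inter> reciprocal_ring TYPE('a)"
  then show "r * x \<in> neg \<inter> reciprocal_ring TYPE('a)"
    using reciprocal_ring_nonpos by (auto intro: reciprocal_ring_mult neg_mult)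
next
  fix x y assume "x \<in> reciprocal_ring TYPE('a)" "y \<in> reciprocal_ring TYPE('a)"
    and "x * y \<in> neg \<inter> reciprocal_ring TYPE('a)"
  then show "x \<in> neg \<inter> reciprocal_ring TYPE('a) \<or> y \<in> neg \<inter> reciprocal_ring TYPE('a)"
    using reciprocal_ring_nonpos neg_prime by auto
qed simp

end

section \<open>Lexicographic degrees and a chain of primes\<close>

lemma single_eq_0_iff: "Poly_Mapping.single m c = 0 \<longleftrightarrow> c = 0"
proof
  assume "Poly_Mapping.single m c = 0"
  then have "Poly_Mapping.lookup (Poly_Mapping.single m c) m = 0" by simp
  then show "c = 0" by simp
qed simp

text \<open>
  The leading monomial. The order on exponent vectors is lexicographic, the smallest variable
  being the most significant one.
\<close>

definition lead :: "('m::linorder \<Rightarrow>\<^sub>0 'k::zero) \<Rightarrow> 'm" where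
  "lead f = Max (Poly_Mapping.keys f)"

lemma lead_in_keys: "f \<noteq> 0 \<Longrightarrow> lead f \<in> Poly_Mapping.keys f"
  unfolding lead_def by (rule Max_in) (simp_all add: poly_mapping_eq_iff fun_eq_iff set_eq_iff in_keys_iff)

lemma le_lead: "m \<in> Poly_Mapping.keys f \<Longrightarrow> m \<le> lead f"
  by (simp add: lead_def)

lemma lead_single: "c \<noteq> 0 \<Longrightarrow> lead (Poly_Mapping.single m c) = m"
  by (simp add: lead_def)

lemma lead_add:
  fixes f g :: "'m::linorder \<Rightarrow>\<^sub>0 'k::monoid_add"
  assumes "f + g \<noteq> 0"
  shows "lead (f + g) \<le> max (lead f) (lead g)"
proof -
  have "lead (f + g) \<in> Poly_Mapping.keys f \<union> Poly_Mapping.keys g"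
    by (rule subsetD[OF keys_add lead_in_keys[OF assms]])
  then show ?thesis using le_lead by (auto simp: le_max_iff_disj)
qed

text \<open>
  The product of the leading monomials occurs in \<open>f * g\<close> in only one way, so its coefficient is the
  product of two nonzero leading coefficients. This is seen by splitting off the leading term
  \<open>top\<close> of each factor: a product that involves a remainder \<open>low\<close> has only smaller monomials.
\<close>

lemma lead_mult:
  fixes f g :: "'m::{linordered_cancel_ab_semigroup_add, ordered_comm_monoid_add} \<Rightarrow>\<^sub>0 'k::idom"
  assumes "f \<noteq> 0" "g \<noteq> 0"
  shows "lead (f * g) = lead f + lead g"
proof -
  define top where "top h = Poly_Mapping.single (lead h) (Poly_Mapping.lookup h (lead h))" for h :: "'m \<Rightarrow>\<^sub>0 'k"
  define low where "low h = h - top h" for h :: "'m \<Rightarrow>\<^sub>0 'k"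
  have low_keys: "m < lead h" if "m \<in> Poly_Mapping.keys (low h)" for m h
  proof -
    have "m \<noteq> lead h" "m \<in> Poly_Mapping.keys h"
      using that by (auto simp: in_keys_iff low_def top_def lookup_minus lookup_single when_def split: if_splits)
    then show ?thesis using le_lead[of m h] by simp
  qed
  have le: "m \<le> lead f + lead g" if "m \<in> Poly_Mapping.keys (f * g)" for m
    using subsetD[OF keys_mult that] le_lead by (auto intro: add_mono)
  have "Poly_Mapping.lookup (low f * g) (lead f + lead g) = 0"
  proof (rule ccontr)
    assume "\<not> ?thesis"
    then have "lead f + lead g \<in> Poly_Mapping.keys (low f * g)" by (simp add: in_keys_iff)
    then obtain a b where "lead f + lead g = a + b" "a < lead f" "b \<le> lead g"
      using keys_mult[of "low f" g] low_keys le_lead by blast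
    then show False using add_less_le_mono[of a "lead f" b "lead g"] by simp
  qed
  moreover have "Poly_Mapping.lookup (top f * low g) (lead f + lead g) = 0"
  proof (rule ccontr)
    assume "\<not> ?thesis"
    then have "lead f + lead g \<in> Poly_Mapping.keys (top f * low g)" by (simp add: in_keys_iff)
    then obtain a b where ab: "lead f + lead g = a + b" "a \<in> Poly_Mapping.keys (top f)" "b < lead g"
      using keys_mult[of "top f" "low g"] low_keys by blast
    then have "a = lead f" by (simp add: top_def split: if_splits)
    with ab show False by simp
  qed
  moreover have "f * g = top f * top g + top f * low g + low f * g"
    by (simp add: low_def algebra_simps)
  moreover have "Poly_Mapping.lookup (top f * top g) (lead f + lead g) = Poly_Mapping.lookup f (lead f) * Poly_Mapping.lookup g (lead g)"
    by (simp add: top_def mult_single)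
  ultimately have "Poly_Mapping.lookup (f * g) (lead f + lead g) = Poly_Mapping.lookup f (lead f) * Poly_Mapping.lookup g (lead g)"
    by (simp add: lookup_add)
  also have "\<dots> \<noteq> 0" using assms[THEN lead_in_keys] by (simp add: in_keys_iff)
  finally have in_keys: "lead f + lead g \<in> Poly_Mapping.keys (f * g)" by (simp add: in_keys_iff)
  then have "f * g \<noteq> 0" by auto
  then show ?thesis using le[OF lead_in_keys] le_lead[OF in_keys] by (simp add: order.antisym)
qed

definition restrict_exponents :: "'v set \<Rightarrow> ('v \<Rightarrow>\<^sub>0 nat) \<Rightarrow> ('v \<Rightarrow>\<^sub>0 nat)" where
  "restrict_exponents S = Poly_Mapping.mapp (\<lambda>v e. e when v \<in> S)"

lemma lookup_restrict_exponents:
  "Poly_Mapping.lookup (restrict_exponents S m) v = (Poly_Mapping.lookup m v when v \<in> S)"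
  by (simp add: restrict_exponents_def lookup_mapp when_def in_keys_iff)

lemma restrict_exponents_add:
  "restrict_exponents S (m + n) = restrict_exponents S m + restrict_exponents S n"
  by (rule poly_mapping_eqI) (simp add: lookup_restrict_exponents lookup_add when_def)

lemma restrict_exponents_restrict:
  "S \<subseteq> S' \<Longrightarrow> restrict_exponents S (restrict_exponents S' m) = restrict_exponents S m"
  by (rule poly_mapping_eqI) (auto simp: lookup_restrict_exponents when_def)

lemma less_poly_mapping_iff:
  "m < n \<longleftrightarrow> (\<exists>k. Poly_Mapping.lookup m k < Poly_Mapping.lookup n k \<and> (\<forall>k'<k. Poly_Mapping.lookup m k' = Poly_Mapping.lookup n k'))"
  by (simp add: less_poly_mapping.rep_eq less_fun_def)

lemma zero_le_exponents: "0 \<le> (m :: 'v::linorder \<Rightarrow>\<^sub>0 nat)"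
  by (simp add: not_less[symmetric] less_poly_mapping_iff)

text \<open>
  Forgetting variables respects the lexicographic order only when the variables that are kept are
  the most significant ones.
\<close>

definition initial_segment :: "'v::linorder set \<Rightarrow> bool" where
  "initial_segment S \<longleftrightarrow> (\<forall>v\<in>S. {..v} \<subseteq> S)"

lemma restrict_exponents_mono:
  fixes m n :: "'v::linorder \<Rightarrow>\<^sub>0 nat"
  assumes lower: "initial_segment S" and "m \<le> n"
  shows "restrict_exponents S m \<le> restrict_exponents S n"
proof (cases "m = n")
  case False
  with \<open>m \<le> n\<close> obtain k where k: "Poly_Mapping.lookup m k < Poly_Mapping.lookup n k" "\<forall>k'<k. Poly_Mapping.lookup m k' = Poly_Mapping.lookup n k'"
    using less_poly_mapping_iff[of m n] by auto
  \<comment> \<open>The first variable at which the two vectors differ is either kept, or nothing after it is kept.\<close>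
  show ?thesis
  proof (cases "k \<in> S")
    case True
    then have "restrict_exponents S m < restrict_exponents S n"
      unfolding less_poly_mapping_iff using k by (auto simp: lookup_restrict_exponents intro!: exI[of _ k])
    then show ?thesis by simp
  next
    case False
    then have "Poly_Mapping.lookup m v = Poly_Mapping.lookup n v" if "v \<in> S" for v
      using k(2) lower that False by (force simp: initial_segment_def not_le[symmetric])
    then have "restrict_exponents S m = restrict_exponents S n"
      by (intro poly_mapping_eqI) (simp add: lookup_restrict_exponents when_def)
    then show ?thesis by simp
  qed
qed simp

definition partial_degree :: "'v set \<Rightarrow> ('k::zero, 'v::linorder) mpolys \<Rightarrow> ('v \<Rightarrow>\<^sub>0 nat)" where
  "partial_degree S f = restrict_exponents S (lead f)"

lemma degree_map_partial_degree:
  fixes S :: "'v::linorder set"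
  assumes lower: "initial_segment S"
  shows "degree_map (partial_degree S :: ('k::idom, 'v) mpolys \<Rightarrow> _)"
proof
  fix f g :: "('k, 'v) mpolys"
  show "0 \<le> partial_degree S f" by (rule zero_le_exponents)
  show "partial_degree S (f * g) = partial_degree S f + partial_degree S g" if "f \<noteq> 0" "g \<noteq> 0"
    using that by (simp add: partial_degree_def lead_mult restrict_exponents_add)
  have mono: "mono (restrict_exponents S)"
    by (rule monoI, rule restrict_exponents_mono[OF lower])
  show "partial_degree S (f + g) \<le> max (partial_degree S f) (partial_degree S g)" if "f + g \<noteq> 0"
    using monoD[OF mono lead_add[OF that]] by (simp add: partial_degree_def max_of_mono[OF mono])
qed

text \<open>
  A strict inequality between restrictions persists when more, less significant, variables are taken
  into account, which gives the inclusion. It is strict because the reciprocal of a variable in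
  \<open>S' - S\<close> has negative degree for \<open>S'\<close> but degree \<open>0\<close> for \<open>S\<close>.
\<close>

lemma neg_partial_degree_strict_mono:
  fixes S :: "'v::linorder set"
  assumes lower: "initial_segment S"
    and lower': "initial_segment S'"
    and "S \<subset> S'"
  defines "Q \<equiv> \<lambda>S. degree_map.neg (partial_degree S :: ('k::idom, 'v) mpolys \<Rightarrow> _)
                       \<inter> reciprocal_ring TYPE(('k, 'v) mpolys)"
  shows "Q S \<subset> Q S'"
proof -
  interpret S: degree_map "partial_degree S :: ('k, 'v) mpolys \<Rightarrow> _"
    by (rule degree_map_partial_degree[OF lower])
  interpret S': degree_map "partial_degree S' :: ('k, 'v) mpolys \<Rightarrow> _"
    by (rule degree_map_partial_degree[OF lower'])
  have less: "restrict_exponents S' m < restrict_exponents S' n"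
    if "restrict_exponents S m < restrict_exponents S n" for m n
  proof (rule ccontr)
    assume "\<not> ?thesis"
    then have "restrict_exponents S (restrict_exponents S' n) \<le> restrict_exponents S (restrict_exponents S' m)"
      by (simp add: restrict_exponents_mono[OF lower])
    then show False using that \<open>S \<subset> S'\<close> by (simp add: restrict_exponents_restrict)
  qed
  have "S.neg \<subseteq> S'.neg"
    using less by (auto simp: S.neg_def S'.Fract_in_neg_iff partial_degree_def)
  moreover obtain v where v: "v \<in> S'" "v \<notin> S" using \<open>S \<subset> S'\<close> by blast
  define y :: "('k, 'v) mpolys" where "y = Poly_Mapping.single (Poly_Mapping.single v 1) 1"
  have y: "y \<noteq> 0" "lead y = Poly_Mapping.single v 1"
    using lead_single[of "1::'k"] by (simp_all add: y_def single_eq_0_iff)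
  have one: "lead (1 :: ('k, 'v) mpolys) = 0"
    using lead_single[of "1::'k" "0 :: 'v \<Rightarrow>\<^sub>0 nat"] by simp
  have "restrict_exponents S (Poly_Mapping.single v 1) = 0" "restrict_exponents S 0 = 0"
       "restrict_exponents S' 0 = 0" "restrict_exponents S' (Poly_Mapping.single v 1) = Poly_Mapping.single v 1"
    using v by (auto intro!: poly_mapping_eqI simp: lookup_restrict_exponents lookup_single when_def)
  moreover have "0 < Poly_Mapping.single v (1::nat)"
    using zero_le_exponents[of "Poly_Mapping.single v 1"] single_eq_0_iff[of v "1::nat"]
    by (metis order.not_eq_order_implies_strict zero_neq_one)
  ultimately have "Fraction_Field.Fract 1 y \<in> Q S'" "Fraction_Field.Fract 1 y \<notin> Q S"
    using y by (simp_all add: Q_def S.Fract_in_neg_iff S'.Fract_in_neg_iff partial_degree_def one reciprocal_ring_inverse)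
  then show ?thesis using \<open>S.neg \<subseteq> S'.neg\<close> by (auto simp: Q_def)
qed

lemma initial_segments:
  obtains S :: "nat \<Rightarrow> 'v::{finite, linorder} set"
  where "\<And>j. initial_segment (S j)"
    and "\<And>j. j < CARD('v) \<Longrightarrow> S j \<subset> S (Suc j)"
proof -
  define vs :: "'v list" where "vs = sorted_list_of_set UNIV"
  have vs: "sorted_wrt (<) vs" "set vs = UNIV" "length vs = CARD('v)"
    by (simp_all add: vs_def)
  define S where "S j = (!) vs ` {i. i < j \<and> i < CARD('v)}" for j
  show thesis
  proof
    fix j
    have "w \<in> S j" if vw: "v \<in> S j" "w \<le> v" for v w
    proof -
      obtain i where i: "v = vs ! i" "i < j" "i < CARD('v)" using vw(1) by (auto simp: S_def)
      obtain l where l: "w = vs ! l" "l < CARD('v)"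
        using vs(2,3) by (metis UNIV_I in_set_conv_nth)
      have "l \<le> i"
        using sorted_wrt_nth_less[OF vs(1), of i l] i l vs(3) \<open>w \<le> v\<close> by (cases "i < l") auto
      with i l show "w \<in> S j" by (auto simp: S_def)
    qed
    then show "initial_segment (S j)" by (auto simp: initial_segment_def)
  next
    fix j assume j: "j < CARD('v)"
    have "vs ! j \<notin> S j"
      using sorted_wrt_nth_less[OF vs(1), of _ j] j vs(3) by (fastforce simp: S_def)
    moreover have "vs ! j \<in> S (Suc j)" "S j \<subseteq> S (Suc j)"
      using j by (auto simp: S_def)
    ultimately show "S j \<subset> S (Suc j)" by blast
  qed
qed

lemma prime_chain_exists:
  obtains P where "\<And>j. primeideal (P j) (reciprocal_complement TYPE(('k::idom, 'v::{finite, linorder}) mpolys))"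
    and "\<And>j. j < CARD('v) \<Longrightarrow> P j \<subset> P (Suc j)"
proof -
  obtain S :: "nat \<Rightarrow> 'v set" where S: "\<And>j. initial_segment (S j)"
    "\<And>j. j < CARD('v) \<Longrightarrow> S j \<subset> S (Suc j)"
    by (rule initial_segments) blast
  show thesis
  proof (rule that)
    show "primeideal (degree_map.neg (partial_degree (S j) :: ('k, 'v) mpolys \<Rightarrow> _)
            \<inter> reciprocal_ring TYPE(('k, 'v) mpolys)) (reciprocal_complement TYPE(('k, 'v) mpolys))" for j
      by (rule degree_map.primeideal_neg[OF degree_map_partial_degree[OF S(1)]])
    show "degree_map.neg (partial_degree (S j) :: ('k, 'v) mpolys \<Rightarrow> _) \<inter> reciprocal_ring TYPE(('k, 'v) mpolys)
        \<subset> degree_map.neg (partial_degree (S (Suc j)) :: ('k, 'v) mpolys \<Rightarrow> _) \<inter> reciprocal_ring TYPE(('k, 'v) mpolys)"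
      if "j < CARD('v)" for j
      by (rule neg_partial_degree_strict_mono[OF S(1) S(1) S(2)[OF that]])
  qed
qed

section \<open>Algebraic independence along a chain of primes\<close>

definition monomial_at :: "'b::comm_monoid_mult list \<Rightarrow> nat list \<Rightarrow> 'b" where
  "monomial_at xs es = (\<Prod>(x, e)\<leftarrow>zip xs es. x ^ e)"

lemma monomial_at_simps [simp]:
  "monomial_at [] es = 1"
  "monomial_at (x # xs) (e # es) = x ^ e * monomial_at xs es"
  by (simp_all add: monomial_at_def)

lemma reciprocal_ring_power:
  "x \<in> reciprocal_ring TYPE('a::idom) \<Longrightarrow> x ^ n \<in> reciprocal_ring TYPE('a)"
  by (induction n) (simp_all add: reciprocal_ring_one reciprocal_ring_mult)

lemma reciprocal_ring_sum:
  "(\<And>i. i \<in> A \<Longrightarrow> f i \<in> reciprocal_ring TYPE('a::idom)) \<Longrightarrow> sum f A \<in> reciprocal_ring TYPE('a)"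
  by (induction A rule: infinite_finite_induct) (simp_all add: reciprocal_ring_zero reciprocal_ring_add)

lemma reciprocal_ring_monomial_at:
  "set xs \<subseteq> reciprocal_ring TYPE('a::idom) \<Longrightarrow> monomial_at xs es \<in> reciprocal_ring TYPE('a)"
proof (induction xs arbitrary: es)
  case (Cons x xs)
  then show ?case
    by (cases es) (auto simp: monomial_at_def reciprocal_ring_one intro!: reciprocal_ring_mult reciprocal_ring_power)
qed (simp add: reciprocal_ring_one)

lemma primeideal_sum:
  assumes "primeideal P (reciprocal_complement TYPE('a::idom))" "\<And>i. i \<in> A \<Longrightarrow> f i \<in> P"
  shows "sum f A \<in> P"
  using assms(2)
  by (induction A rule: infinite_finite_induct)
     (simp_all add: primeideal_reciprocal_complementD(2,4)[OF assms(1)])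

lemma primeideal_power:
  assumes "primeideal P (reciprocal_complement TYPE('a::idom))" "x \<in> reciprocal_ring TYPE('a)" "x ^ n \<in> P"
  shows "x \<in> P"
  using assms(3)
proof (induction n)
  case 0
  then show ?case using primeideal_reciprocal_complementD(3)[OF assms(1)] by simp
next
  case (Suc n)
  then show ?case
    using primeideal_reciprocal_complementD(6)[OF assms(1,2) reciprocal_ring_power[OF assms(2)]] by auto
qed

text \<open>
  A polynomial relation is a sum over exponent vectors, written as lists, and its coefficients
  are zero or units of the ring. The induction on the list \<open>xs\<close> drops the first prime of the chain;
  for this to work the relation is only required to hold modulo \<open>P 0\<close>. When no element is left, the
  relation says that a constant lies in a prime, and a unit cannot.
\<close>

lemma prime_chain_independent:
  fixes P :: "nat \<Rightarrow> 'a::idom fract set" and c :: "nat list \<Rightarrow> 'a fract"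
  assumes "\<And>j. j \<le> length xs \<Longrightarrow> primeideal (P j) (reciprocal_complement TYPE('a))"
    and "\<And>j. j < length xs \<Longrightarrow> P j \<subseteq> P (Suc j) \<and> xs ! j \<in> P (Suc j) \<and> xs ! j \<notin> P j"
    and "finite A" "\<And>es. es \<in> A \<Longrightarrow> length es = length xs"
    and "\<And>es. es \<in> A \<Longrightarrow> c es \<in> reciprocal_ring TYPE('a)"
    and "\<And>es. es \<in> A \<Longrightarrow> c es \<noteq> 0 \<Longrightarrow> inverse (c es) \<in> reciprocal_ring TYPE('a)"
    and "(\<Sum>es\<in>A. c es * monomial_at xs es) \<in> P 0"
  shows "\<forall>es\<in>A. c es = 0"
  using assms
proof (induction xs arbitrary: P A c)
  case Nil
  note prime = primeideal_reciprocal_complementD[OF Nil.prems(1)[of 0, simplified]]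
  show ?case
  proof (rule ballI, rule ccontr)
    fix es assume "es \<in> A" "c es \<noteq> 0"
    then have A: "A = {[]}" and es: "es = []" using Nil.prems(4) by auto
    then have "c es \<in> P 0" using Nil.prems(7) by simp
    then have "inverse (c es) * c es \<in> P 0"
      using Nil.prems(6)[OF \<open>es \<in> A\<close> \<open>c es \<noteq> 0\<close>] prime(5) by blast
    then show False using prime(3) \<open>c es \<noteq> 0\<close> by simp
  qed
next
  case (Cons x xs)
  have prime0: "primeideal (P 0) (reciprocal_complement TYPE('a))"
    and prime1: "primeideal (P 1) (reciprocal_complement TYPE('a))"
    using Cons.prems(1) by simp_all
  note P0 = primeideal_reciprocal_complementD[OF prime0]
    and P1 = primeideal_reciprocal_complementD[OF prime1]
  have sub: "P 0 \<subseteq> P 1" and x: "x \<in> P 1" "x \<notin> P 0" using Cons.prems(2)[of 0] by auto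
  have x_ring: "x \<in> reciprocal_ring TYPE('a)" using P1(1) x by blast
  have xs_ring: "set xs \<subseteq> reciprocal_ring TYPE('a)"
  proof
    fix y assume "y \<in> set xs"
    then obtain j where j: "j < length xs" "y = xs ! j" by (auto simp: in_set_conv_nth)
    then have "y \<in> P (Suc (Suc j))" using Cons.prems(2)[of "Suc j"] by simp
    then show "y \<in> reciprocal_ring TYPE('a)"
      using primeideal_reciprocal_complementD(1)[OF Cons.prems(1)[of "Suc (Suc j)"]] j by auto
  qed
  define A' where "A' = {es \<in> A. c es \<noteq> 0}"
  have fin: "finite A'" using Cons.prems(3) by (simp add: A'_def)
  have "A' = {}"
  proof (rule ccontr)
    assume ne: "A' \<noteq> {}"
    define e where "e = Min (hd ` A')"
    define B where "B = {es \<in> A'. hd es = e}"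
    have e_le: "e \<le> hd es" if "es \<in> A'" for es using that fin by (simp add: e_def)
    have "e \<in> hd ` A'" unfolding e_def using fin ne by (intro Min_in) auto
    then have "B \<noteq> {}" by (auto simp: B_def)
    have split: "es = hd es # tl es" "length (tl es) = length xs" if "es \<in> A'" for es
      using that Cons.prems(4)[of es] by (auto simp: A'_def neq_Nil_conv length_Suc_conv)
    \<comment> \<open>The term of \<open>es\<close> divided by \<open>x ^ e\<close>, the smallest power of \<open>x\<close> that occurs.\<close>
    define t where "t es = c es * (x ^ (hd es - e) * monomial_at xs (tl es))" for es
    have t_ring: "t es \<in> reciprocal_ring TYPE('a)" if "es \<in> A'" for es
      using that Cons.prems(5) x_ring xs_ring
      by (auto simp: A'_def t_def intro!: reciprocal_ring_mult reciprocal_ring_power reciprocal_ring_monomial_at)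
    have "(\<Sum>es\<in>A. c es * monomial_at (x # xs) es) = (\<Sum>es\<in>A'. c es * monomial_at (x # xs) es)"
      by (rule sum.mono_neutral_right) (use Cons.prems(3) in \<open>auto simp: A'_def\<close>)
    also have "\<dots> = (\<Sum>es\<in>A'. x ^ e * t es)"
    proof (rule sum.cong)
      fix es assume es: "es \<in> A'"
      have "monomial_at (x # xs) es = x ^ hd es * monomial_at xs (tl es)"
        using split(1)[OF es] monomial_at_simps(2) by metis
      moreover have "x ^ hd es = x ^ e * x ^ (hd es - e)"
        using e_le[OF es] by (simp flip: power_add)
      ultimately show "c es * monomial_at (x # xs) es = x ^ e * t es"
        by (simp add: t_def algebra_simps)
    qed simp
    also have "\<dots> = x ^ e * sum t A'" by (simp add: sum_distrib_left)
    finally have "x ^ e * sum t A' \<in> P 0" using Cons.prems(7) by simp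
    then have "x ^ e \<in> P 0 \<or> sum t A' \<in> P 0"
      using P0(6)[OF reciprocal_ring_power[OF x_ring] reciprocal_ring_sum[of A' t]] t_ring by blast
    then have "sum t A' \<in> P 0"
      using primeideal_power[OF prime0 x_ring] x(2) by blast
    then have sum_A': "sum t A' \<in> P 1" using sub by blast
    \<comment> \<open>Outside \<open>B\<close> a factor \<open>x\<close> is left, so modulo \<open>P 1\<close> only the terms in \<open>B\<close> survive.\<close>
    have "sum t (A' - B) \<in> P 1"
    proof (rule primeideal_sum[OF prime1])
      fix es assume es: "es \<in> A' - B"
      then have "hd es - e \<noteq> 0" using e_le[of es] by (auto simp: B_def)
      then obtain n where "hd es - e = Suc n" using not0_implies_Suc by blast
      then have "t es = (c es * x ^ n * monomial_at xs (tl es)) * x" by (simp add: t_def algebra_simps)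
      moreover have "c es * x ^ n * monomial_at xs (tl es) \<in> reciprocal_ring TYPE('a)"
        using es Cons.prems(5) x_ring xs_ring
        by (auto simp: A'_def intro!: reciprocal_ring_mult reciprocal_ring_power reciprocal_ring_monomial_at)
      ultimately show "t es \<in> P 1" using P1(5) x(1) by simp
    qed
    then have "(-1) * sum t (A' - B) \<in> P 1"
      by (intro P1(5) reciprocal_ring_uminus reciprocal_ring_one)
    then have "sum t A' + (-1) * sum t (A' - B) \<in> P 1" using sum_A' P1(4) by blast
    moreover have "sum t A' = sum t B + sum t (A' - B)"
      using fin by (subst sum.subset_diff[of B A']) (auto simp: B_def)
    ultimately have "sum t B \<in> P 1" by simp
    moreover have "inj_on tl B"
      using split(1) by (intro inj_onI) (metis (mono_tags, lifting) B_def mem_Collect_eq)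
    then have "sum t B = (\<Sum>es\<in>tl ` B. c (e # es) * monomial_at xs es)"
      using split(1) by (subst sum.reindex) (auto simp: t_def B_def intro!: sum.cong)
    ultimately have tail: "(\<Sum>es\<in>tl ` B. c (e # es) * monomial_at xs es) \<in> P 1" by simp
    have in_A: "e # es \<in> A \<and> length es = length xs \<and> c (e # es) \<noteq> 0" if "es \<in> tl ` B" for es
      using that split by (auto simp: B_def A'_def)
    have "\<forall>es\<in>tl ` B. c (e # es) = 0"
    proof (rule Cons.IH[of "\<lambda>j. P (Suc j)"])
      show "finite (tl ` B)" using fin by (simp add: B_def)
      show "(\<Sum>es\<in>tl ` B. c (e # es) * monomial_at xs es) \<in> P (Suc 0)" using tail by simp
      show "primeideal (P (Suc j)) (reciprocal_complement TYPE('a))" if "j \<le> length xs" for j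
        using Cons.prems(1)[of "Suc j"] that by simp
      show "P (Suc j) \<subseteq> P (Suc (Suc j)) \<and> xs ! j \<in> P (Suc (Suc j)) \<and> xs ! j \<notin> P (Suc j)"
        if "j < length xs" for j
        using Cons.prems(2)[of "Suc j"] that by simp
    qed (use in_A Cons.prems(5,6) in blast)+
    then show False using in_A \<open>B \<noteq> {}\<close> by blast
  qed
  then show ?case by (auto simp: A'_def)
qed

section \<open>Counting monomials\<close>

text \<open>
  Bounding each exponent separately, instead of the total degree, makes the space of bounded
  polynomials have dimension \<open>(M + 1) ^ n\<close> and spares all binomial coefficients.
\<close>

definition exponents_le :: "nat \<Rightarrow> ('k::zero, 'v) mpolys \<Rightarrow> bool" where
  "exponents_le M p \<longleftrightarrow> (\<forall>m\<in>Poly_Mapping.keys p. \<forall>v. Poly_Mapping.lookup m v \<le> M)"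

lemma exponents_le_mono: "exponents_le M p \<Longrightarrow> M \<le> N \<Longrightarrow> exponents_le N p"
  unfolding exponents_le_def by (meson le_trans)

lemma exponents_le_one: "exponents_le M (1 :: ('k::comm_semiring_1, 'v) mpolys)"
  by (auto simp: exponents_le_def in_keys_iff lookup_one when_def split: if_splits)

lemma exponents_le_mult:
  fixes p q :: "('k::comm_semiring_1, 'v) mpolys"
  assumes "exponents_le M p" "exponents_le N q"
  shows "exponents_le (M + N) (p * q)"
  unfolding exponents_le_def
proof (intro ballI allI)
  fix m v assume "m \<in> Poly_Mapping.keys (p * q)"
  then obtain a b where "m = a + b" "a \<in> Poly_Mapping.keys p" "b \<in> Poly_Mapping.keys q"
    using keys_mult[of p q] by blast
  then show "Poly_Mapping.lookup m v \<le> M + N"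
    using assms by (auto simp: exponents_le_def lookup_add intro: add_mono)
qed

lemma exponents_le_power:
  fixes p :: "('k::comm_semiring_1, 'v) mpolys"
  shows "exponents_le M p \<Longrightarrow> exponents_le (n * M) (p ^ n)"
  by (induction n) (simp_all add: exponents_le_one exponents_le_mult)

lemma exponents_le_exists: "\<exists>M. exponents_le M (p :: ('k::zero, 'v::finite) mpolys)"
proof -
  have "finite ((\<lambda>(m, v). Poly_Mapping.lookup m v) ` (Poly_Mapping.keys p \<times> UNIV))" by simp
  then obtain M where "\<forall>e \<in> (\<lambda>(m, v). Poly_Mapping.lookup m v) ` (Poly_Mapping.keys p \<times> UNIV). e \<le> M"
    unfolding finite_nat_set_iff_bounded_le by blast
  then show ?thesis by (auto simp: exponents_le_def)
qed

lemma common_exponents_le: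
  fixes fracs :: "(('k::zero, 'v::finite) mpolys \<times> ('k, 'v) mpolys) list"
  shows "\<exists>M. \<forall>(a, b)\<in>set fracs. exponents_le M a \<and> exponents_le M b"
proof (induction fracs)
  case (Cons ab fracs)
  then obtain M where M: "\<forall>(a, b)\<in>set fracs. exponents_le M a \<and> exponents_le M b" by blast
  obtain Ma Mb where "exponents_le Ma (fst ab)" "exponents_le Mb (snd ab)"
    using exponents_le_exists by blast
  with M have "\<forall>(a, b)\<in>set (ab # fracs). exponents_le (M + Ma + Mb) a \<and> exponents_le (M + Ma + Mb) b"
    by (fastforce elim: exponents_le_mono)
  then show ?case by blast
qed simp

lemma card_bounded_exponents:
  "finite {m :: 'v::finite \<Rightarrow>\<^sub>0 nat. \<forall>v. Poly_Mapping.lookup m v \<le> M}"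
  "card {m :: 'v::finite \<Rightarrow>\<^sub>0 nat. \<forall>v. Poly_Mapping.lookup m v \<le> M} \<le> (M + 1) ^ CARD('v)"
proof -
  let ?E = "{m :: 'v::finite \<Rightarrow>\<^sub>0 nat. \<forall>v. Poly_Mapping.lookup m v \<le> M}"
  have inj: "inj_on Poly_Mapping.lookup ?E" by (auto intro: inj_onI poly_mapping_eqI)
  have sub: "Poly_Mapping.lookup ` ?E \<subseteq> (UNIV \<rightarrow>\<^sub>E {..M})" by auto
  have fin: "finite ((UNIV :: 'v set) \<rightarrow>\<^sub>E {..M})" by (simp add: finite_PiE)
  show "finite ?E" using inj_on_finite[OF inj sub fin] .
  show "card ?E \<le> (M + 1) ^ CARD('v)"
    using card_inj_on_le[OF inj sub fin] by (simp add: card_PiE)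
qed

text \<open>
  The families considered here may repeat a vector, so the bound on independent sets is needed in
  the form for families.
\<close>

lemma (in vector_space) family_dependent:
  fixes f :: "'i \<Rightarrow> 'b"
  assumes "finite T" "finite I" "\<And>i. i \<in> I \<Longrightarrow> f i \<in> span T" "card T < card I"
  shows "\<exists>c :: 'i \<Rightarrow> 'a. (\<exists>i\<in>I. c i \<noteq> 0) \<and> (\<Sum>i\<in>I. c i *s f i) = 0"
proof (cases "inj_on f I")
  case True
  have "dependent (f ` I)"
  proof (rule ccontr)
    assume "independent (f ` I)"
    then have "card (f ` I) \<le> card T" using independent_span_bound[OF assms(1)] assms(3) by blast
    then show False using assms(4) card_image[OF True] by simp
  qed
  then obtain u where u: "\<exists>v\<in>f ` I. u v \<noteq> 0" "(\<Sum>v\<in>f ` I. u v *s v) = 0"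
    using dependent_finite[of "f ` I"] assms(2) by auto
  then show ?thesis
    by (intro exI[of _ "u \<circ> f"]) (auto simp: sum.reindex[OF True])
next
  case False
  then obtain i j where ij: "i \<in> I" "j \<in> I" "i \<noteq> j" "f i = f j" by (auto simp: inj_on_def)
  define c :: "'i \<Rightarrow> 'a" where "c k = (if k = i then 1 else if k = j then -1 else 0)" for k
  have "(\<Sum>k\<in>I. c k *s f k) = (\<Sum>k\<in>{i, j}. c k *s f k)"
    by (rule sum.mono_neutral_right) (use ij assms(2) in \<open>auto simp: c_def\<close>)
  also have "\<dots> = 0" using ij by (simp add: c_def)
  finally show ?thesis using ij(1) by (intro exI[of _ c]) (auto simp: c_def)
qed

interpretation mpolys: vector_space "\<lambda>c p. Poly_Mapping.single 0 c * (p :: ('k::field, 'v) mpolys)"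
  by unfold_locales (simp_all add: algebra_simps single_add mult_single flip: mult.assoc)

lemma exponents_le_span:
  fixes p :: "('k::field, 'v) mpolys"
  assumes "exponents_le M p"
  shows "p \<in> mpolys.span ((\<lambda>m. Poly_Mapping.single m 1) ` {m. \<forall>v. Poly_Mapping.lookup m v \<le> M})"
proof -
  have "p = (\<Sum>m\<in>Poly_Mapping.keys p. Poly_Mapping.single m (Poly_Mapping.lookup p m))"
    by (rule poly_mapping_eqI)
       (auto simp: lookup_sum lookup_single when_def sum.delta' sum.delta in_keys_iff)
  also have "\<dots> = (\<Sum>m\<in>Poly_Mapping.keys p. Poly_Mapping.single 0 (Poly_Mapping.lookup p m) * Poly_Mapping.single m 1)"
    by (simp add: mult_single)
  also have "\<dots> \<in> mpolys.span ((\<lambda>m. Poly_Mapping.single m 1) ` {m. \<forall>v. Poly_Mapping.lookup m v \<le> M})"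
    using assms
    by (intro mpolys.span_sum mpolys.span_scale mpolys.span_base) (auto simp: exponents_le_def)
  finally show ?thesis .
qed

abbreviation embed :: "'a::idom \<Rightarrow> 'a fract" where
  "embed p \<equiv> Fraction_Field.Fract p 1"

lemma embed_add: "embed (p + q) = embed p + embed q"
  by simp

lemma embed_mult: "embed (p * q) = embed p * embed q"
  by simp

lemma embed_sum: "embed (sum f A) = (\<Sum>i\<in>A. embed (f i))"
  by (induction A rule: infinite_finite_induct) (simp_all add: embed_add Zero_fract_def[symmetric] del: add_fract)

lemma Fract_power: "Fraction_Field.Fract a b ^ n = Fraction_Field.Fract (a ^ n) (b ^ n)"
  by (induction n) (simp_all add: One_fract_def)

text \<open>
  The factor \<open>x ^ e\<close> with \<open>x = a / b\<close> and \<open>e \<le> N\<close> becomes the polynomial \<open>a ^ e * b ^ (N - e)\<close> after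
  multiplication with \<open>b ^ N\<close>. That denominator does not depend on \<open>e\<close>, and the exponents of the
  result grow only linearly with \<open>N\<close>.
\<close>

lemma clear_denominators:
  fixes fracs :: "(('k::field, 'v::{finite, linorder}) mpolys \<times> ('k, 'v) mpolys) list"
  assumes "\<forall>(a, b)\<in>set fracs. b \<noteq> 0 \<and> exponents_le d a \<and> exponents_le d b"
    and "length es = length fracs" "set es \<subseteq> {..N}"
  shows "\<exists>p. exponents_le (length fracs * (N * d)) p \<and>
             embed p = monomial_at (map (\<lambda>(a, b). Fraction_Field.Fract a b) fracs) es
                         * embed (\<Prod>(a, b)\<leftarrow>fracs. b ^ N)"
  using assms
proof (induction fracs arbitrary: es)
  case Nil
  then show ?case by (intro exI[of _ 1]) (simp add: exponents_le_one One_fract_def)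
next
  case (Cons ab fracs)
  obtain a b where ab: "ab = (a, b)" by (cases ab)
  from Cons.prems obtain e es' where es: "es = e # es'" by (cases es) auto
  have e: "e \<le> N" using Cons.prems es by simp
  obtain p where p: "exponents_le (length fracs * (N * d)) p"
    "embed p = monomial_at (map (\<lambda>(a, b). Fraction_Field.Fract a b) fracs) es' * embed (\<Prod>(a, b)\<leftarrow>fracs. b ^ N)"
    using Cons.IH[of es'] Cons.prems es by auto
  define q where "q = a ^ e * b ^ (N - e)"
  have b: "b \<noteq> 0" and bounds: "exponents_le d a" "exponents_le d b" using Cons.prems ab by auto
  have "exponents_le (e * d + (N - e) * d) q"
    unfolding q_def using bounds by (intro exponents_le_mult exponents_le_power)
  then have q: "exponents_le (N * d) q"
    using e by (simp flip: distrib_right)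
  have q_eq: "embed q = Fraction_Field.Fract a b ^ e * embed (b ^ N)"
    using b e by (simp add: Fract_power eq_fract q_def mult.assoc flip: power_add)
  have "embed (q * p) = monomial_at (map (\<lambda>(a, b). Fraction_Field.Fract a b) (ab # fracs)) es
                         * embed (\<Prod>(a, b)\<leftarrow>ab # fracs. b ^ N)"
    unfolding embed_mult q_eq p(2) by (simp add: ab es embed_mult mult_ac del: mult_fract)
  moreover have "exponents_le (length (ab # fracs) * (N * d)) (q * p)"
    using exponents_le_mult[OF q p(1)] by simp
  ultimately show ?case by blast
qed

text \<open>
  With \<open>k > n\<close> elements and \<open>N\<close> as bound on the exponents, there are \<open>(N + 1) ^ k\<close> monomials in a
  space of dimension at most \<open>(k N d + 1) ^ n\<close>.
\<close>

lemma monomials_dependent: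
  fixes xs :: "('k::field, 'v::{finite, linorder}) mpolys fract list"
  assumes "CARD('v) < length xs"
  obtains A and c :: "nat list \<Rightarrow> 'k"
  where "finite A" "\<And>es. es \<in> A \<Longrightarrow> length es = length xs" "\<exists>es\<in>A. c es \<noteq> 0"
    and "(\<Sum>es\<in>A. embed (Poly_Mapping.single 0 (c es)) * monomial_at xs es) = 0"
proof -
  let ?n = "CARD('v)" and ?k = "length xs"
  have "\<forall>x. \<exists>ab. x = Fraction_Field.Fract (fst ab) (snd ab) \<and> snd ab \<noteq> 0"
    for x :: "('k, 'v) mpolys fract" by (metis Fract_cases fst_conv snd_conv)
  then obtain r :: "('k, 'v) mpolys fract \<Rightarrow> ('k, 'v) mpolys \<times> ('k, 'v) mpolys"
    where r: "\<And>x. x = Fraction_Field.Fract (fst (r x)) (snd (r x)) \<and> snd (r x) \<noteq> 0"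
    by metis
  define fracs where "fracs = map r xs"
  have xs: "map (\<lambda>(a, b). Fraction_Field.Fract a b) fracs = xs" and len: "length fracs = ?k"
    using r by (simp_all add: fracs_def case_prod_beta o_def flip: r)
  obtain d where d: "\<forall>(a, b)\<in>set fracs. exponents_le d a \<and> exponents_le d b"
    using common_exponents_le by blast
  then have fracs: "\<forall>(a, b)\<in>set fracs. b \<noteq> 0 \<and> exponents_le d a \<and> exponents_le d b"
    using r by (auto simp: fracs_def) (metis snd_conv)
  \<comment> \<open>The dimension is at most \<open>(s * (N + 1)) ^ n = s ^ n * (N + 1) ^ n\<close>, and \<open>N = s ^ n\<close> makes this\<close>
  \<comment> \<open>smaller than \<open>(N + 1) ^ (n + 1)\<close>.\<close>
  define s where "s = ?k * d + 1"
  define N where "N = s ^ ?n"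
  define M where "M = ?k * (N * d)"
  define A where "A = {es. set es \<subseteq> {..N} \<and> length es = ?k}"
  define T where "T = (\<lambda>m. Poly_Mapping.single m (1::'k)) ` {m :: 'v \<Rightarrow>\<^sub>0 nat. \<forall>v. Poly_Mapping.lookup m v \<le> M}"
  have A: "finite A" "card A = (N + 1) ^ ?k"
    by (simp_all add: A_def finite_lists_length_eq card_lists_length_eq)
  have T: "finite T" "card T \<le> (M + 1) ^ ?n"
    unfolding T_def using card_bounded_exponents[where 'v = 'v] card_image_le le_trans by blast+
  have "card T < card A"
  proof -
    have "M + 1 \<le> s * (N + 1)" by (simp add: M_def s_def algebra_simps)
    then have "(M + 1) ^ ?n \<le> (s * (N + 1)) ^ ?n" by (rule power_mono) simp
    also have "\<dots> = N * (N + 1) ^ ?n" by (simp only: power_mult_distrib N_def)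
    also have "\<dots> < (N + 1) ^ Suc ?n" by simp
    also have "\<dots> \<le> (N + 1) ^ ?k" using assms by (intro power_increasing) auto
    finally show ?thesis using A T by simp
  qed
  define D where "D = embed (\<Prod>(a, b)\<leftarrow>fracs. b ^ N)"
  have "\<forall>es\<in>A. \<exists>p. exponents_le M p \<and> embed p = monomial_at xs es * D"
    using clear_denominators[OF fracs] by (auto simp: A_def M_def D_def len xs)
  then obtain p where p: "\<And>es. es \<in> A \<Longrightarrow> exponents_le M (p es)"
    "\<And>es. es \<in> A \<Longrightarrow> embed (p es) = monomial_at xs es * D"
    by metis
  have "p es \<in> mpolys.span T" if "es \<in> A" for es
    using exponents_le_span[OF p(1)[OF that]] by (simp add: T_def)
  then obtain c where c: "\<exists>es\<in>A. c es \<noteq> 0" "(\<Sum>es\<in>A. Poly_Mapping.single 0 (c es) * p es) = 0"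
    using mpolys.family_dependent[OF T(1) A(1)] \<open>card T < card A\<close> by blast
  have "(\<Sum>es\<in>A. embed (Poly_Mapping.single 0 (c es)) * monomial_at xs es) * D
          = (\<Sum>es\<in>A. embed (Poly_Mapping.single 0 (c es) * p es))"
    unfolding sum_distrib_right
    by (rule sum.cong) (simp_all add: p(2) embed_mult mult.assoc del: mult_fract)
  also have "\<dots> = 0" using c(2) by (simp add: Zero_fract_def flip: embed_sum)
  finally have "(\<Sum>es\<in>A. embed (Poly_Mapping.single 0 (c es)) * monomial_at xs es) * D = 0" .
  moreover have "D \<noteq> 0"
    using fracs by (auto simp: D_def Zero_fract_def eq_fract prod_list_zero_iff)
  ultimately have "(\<Sum>es\<in>A. embed (Poly_Mapping.single 0 (c es)) * monomial_at xs es) = 0" by simp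
  then show thesis using A(1) c(1) by (intro that[of A c]) (auto simp: A_def)
qed

text \<open>
  Only elements \<open>x\<^sub>j \<in> P\<^bsub>j+1\<^esub> - P\<^sub>j\<close> are needed from the chain: they are algebraically independent,
  so there are at most \<open>n\<close> of them. The field \<open>K\<close> supplies unit coefficients.
\<close>

lemma prime_chain_length_le:
  fixes P :: "nat \<Rightarrow> ('k::field, 'v::{finite, linorder}) mpolys fract set"
  assumes prime: "\<And>j. j \<le> k \<Longrightarrow> primeideal (P j) (reciprocal_complement TYPE(('k, 'v) mpolys))"
    and chain: "\<And>j. j < k \<Longrightarrow> P j \<subset> P (Suc j)"
  shows "k \<le> CARD('v)"
proof (rule ccontr)
  assume long: "\<not> k \<le> CARD('v)"
  have "\<forall>j. \<exists>x. j < k \<longrightarrow> x \<in> P (Suc j) \<and> x \<notin> P j" using chain by blast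
  then obtain x where x: "\<And>j. j < k \<Longrightarrow> x j \<in> P (Suc j) \<and> x j \<notin> P j" by metis
  define xs where "xs = map x [0..<k]"
  have "CARD('v) < length xs" using long by (simp add: xs_def)
  then obtain A and c :: "nat list \<Rightarrow> 'k" where A: "finite A" "\<And>es. es \<in> A \<Longrightarrow> length es = length xs"
    "\<exists>es\<in>A. c es \<noteq> 0" "(\<Sum>es\<in>A. embed (Poly_Mapping.single 0 (c es)) * monomial_at xs es) = 0"
    by (rule monomials_dependent) blast
  have inv: "embed (Poly_Mapping.single (0 :: 'v \<Rightarrow>\<^sub>0 nat) u)
               = Fraction_Field.Fract 1 (Poly_Mapping.single 0 (inverse u))" if "u \<noteq> 0" for u :: 'k
    using that by (subst eq_fract) (simp_all add: mult_single single_eq_0_iff)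
  have "\<forall>es\<in>A. embed (Poly_Mapping.single (0 :: 'v \<Rightarrow>\<^sub>0 nat) (c es)) = 0"
  proof (rule prime_chain_independent[of xs P])
    show "(\<Sum>es\<in>A. embed (Poly_Mapping.single 0 (c es)) * monomial_at xs es) \<in> P 0"
      using A(4) primeideal_reciprocal_complementD(2)[OF prime] by simp
    fix es
    show "embed (Poly_Mapping.single (0 :: 'v \<Rightarrow>\<^sub>0 nat) (c es)) \<in> reciprocal_ring TYPE(('k, 'v) mpolys)"
      by (cases "c es = 0")
         (simp_all add: inv single_eq_0_iff reciprocal_ring_inverse reciprocal_ring_zero flip: Zero_fract_def)
    assume "embed (Poly_Mapping.single (0 :: 'v \<Rightarrow>\<^sub>0 nat) (c es)) \<noteq> 0"
    then show "inverse (embed (Poly_Mapping.single (0 :: 'v \<Rightarrow>\<^sub>0 nat) (c es))) \<in> reciprocal_ring TYPE(('k, 'v) mpolys)"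
      by (auto simp: Zero_fract_def eq_fract intro: reciprocal_ring_inverse)
  next
    show "P j \<subseteq> P (Suc j) \<and> xs ! j \<in> P (Suc j) \<and> xs ! j \<notin> P j" if "j < length xs" for j
      using chain[of j] x[of j] that by (auto simp: xs_def)
  qed (use A(1,2) prime in \<open>simp_all add: xs_def\<close>)
  then show False using A(3) by (auto simp: Zero_fract_def eq_fract single_eq_0_iff)
qed

section \<open>The Krull dimension\<close>

theorem theorem4p4:
  shows "krull_dim (reciprocal_complement TYPE(('k::field, 'v::{finite, linorder}) mpolys))
           = enat CARD('v)"
  unfolding krull_dim_def
proof (rule antisym[OF Sup_least Sup_upper])
  fix l :: enat
  assume "l \<in> {enat k | k. \<exists>P :: nat \<Rightarrow> ('k, 'v) mpolys fract set.
            (\<forall>i\<le>k. primeideal (P i) (reciprocal_complement TYPE(('k, 'v) mpolys))) \<and> (\<forall>i<k. P i \<subset> P (Suc i))}"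
  then obtain k and P :: "nat \<Rightarrow> ('k, 'v) mpolys fract set" where "l = enat k"
    and "\<And>j. j \<le> k \<Longrightarrow> primeideal (P j) (reciprocal_complement TYPE(('k, 'v) mpolys))"
    and "\<And>j. j < k \<Longrightarrow> P j \<subset> P (Suc j)"
    by blast
  then show "l \<le> enat CARD('v)"
    using prime_chain_length_le[of k P] by simp
next
  obtain P where "\<And>j. primeideal (P j) (reciprocal_complement TYPE(('k, 'v) mpolys))"
    and "\<And>j. j < CARD('v) \<Longrightarrow> P j \<subset> P (Suc j)"
    by (rule prime_chain_exists[where 'k = 'k and 'v = 'v]) blast
  then show "enat CARD('v) \<in> {enat k | k. \<exists>P :: nat \<Rightarrow> ('k, 'v) mpolys fract set.
            (\<forall>i\<le>k. primeideal (P i) (reciprocal_complement TYPE(('k, 'v) mpolys))) \<and> (\<forall>i<k. P i \<subset> P (Suc i))}"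
    by blast
qed

end
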